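(* For every integer $n>1$, the number of maximal transitive partitions of the set of edges of the transitive tournament $\overrightarrow{K}_n$ is equal to the Catalan number $C_{n-1}:=\frac{1}{n}\binom{2n-2}{n-1}$.
   Context: The transitive tournament $\overrightarrow{K}_n$ is the directed graph with vertex set $\{1,\dots,n\}$ and directed edges $(i,j)$, $1\le i<j\le n$. A transitive $k$-partition of $\overrightarrow{K}_n$ is a (unordered) partition of its edge set into $k$ nonempty blocks such that every cycle of the underlying undirected graph contains two edges belonging to the same block that have opposite orientations with respect to a traversal of the cycle. (Equivalently, for all $i<j<m$ the edge $(i,m)$ lies in the same block as $(i,j)$ or in the same block as $(j,m)$.) The maximal possible number of blocks is $n-1$; a transitive partition is maximal if it has exactly $n-1$ blocks. *)

theory Defs
  imports Complex_Main "HOL-Library.Disjoint_Sets" "Graph_Theory.Graph_Theory"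
begin

definition transitive_tournament :: "nat \<Rightarrow> nat pair_pre_digraph" where
  "transitive_tournament n =
     \<lparr> pverts = {1..n}, parcs = {(i, j). 1 \<le> i \<and> i < j \<and> j \<le> n} \<rparr>"

text \<open>
  A cycle of the underlying undirected graph of \<open>G\<close>, together with a direction of traversal, as the
  list of the arcs of \<open>mk_symmetric G\<close> it runs through. The library's \<^const>\<open>pre_digraph.cycle\<close>
  also admits the closed walk that goes along an edge and straight back, which is not a cycle
  of an undirected simple graph; the length bound excludes it. Meant for \<open>G\<close> without loops and
  without antiparallel arcs.
\<close>

definition undirected_cycle :: "'a pair_pre_digraph \<Rightarrow> ('a \<times> 'a) awalk \<Rightarrow> bool" where
  "undirected_cycle G p \<longleftrightarrow> pre_digraph.cycle (mk_symmetric G) p \<and> 3 \<le> length p"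

text \<open>
  An edge \<open>e\<close> of \<open>G\<close> is traversed by \<open>p\<close> along its orientation if \<open>e \<in> set p\<close>, and against it if
  \<open>prod.swap e \<in> set p\<close>. The edges \<open>e\<close> and \<open>f\<close> below are then automatically distinct, because
  a cycle of length at least 3 does not use an edge in both directions.
\<close>

definition transitive_partition :: "'a pair_pre_digraph \<Rightarrow> nat \<Rightarrow> ('a \<times> 'a) set set \<Rightarrow> bool" where
  "transitive_partition G k P \<longleftrightarrow>
     partition_on (parcs G) P \<and> card P = k \<and>
     (\<forall>p. undirected_cycle G p \<longrightarrow>
        (\<exists>B\<in>P. \<exists>e\<in>B. \<exists>f\<in>B. e \<in> set p \<and> prod.swap f \<in> set p))"

definition maximal_transitive_partition :: "nat \<Rightarrow> (nat \<times> nat) set set \<Rightarrow> bool" where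
  "maximal_transitive_partition n P \<longleftrightarrow>
     transitive_partition (transitive_tournament n) (n - 1) P"

end

theory Submission
  imports Defs
begin

text \<open>
  By the triangle condition every block contains a unit edge \<open>(r, r + 1)\<close>, so with \<open>n - 1\<close> blocks
  each contains exactly one, and a maximal transitive partition amounts to a function \<open>f\<close> with
  \<open>i \<le> f i j < j\<close> and \<open>f i m \<in> {f i j, f j m}\<close>. If \<open>f a b = r\<close>, then \<open>f\<close> is constantly \<open>r\<close> on the
  edges of \<open>{a..b}\<close> from \<open>{a..r}\<close> to \<open>{r + 1..b}\<close> and arbitrary of the same kind on the two parts,
  as for the root of a binary tree; this gives the Catalan recurrence.
\<close>

section \<open>The Catalan recurrence\<close>

text \<open>Absorption is applied twice, passing through row \<open>2 * k + 1\<close>, whose two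
  middle entries agree by symmetry.\<close>

lemma central_binomial_Suc:
  "real (Suc k) * real ((2 * Suc k) choose Suc k) = 2 * (2 * real k + 1) * real ((2 * k) choose k)"
proof -
  have 1: "Suc k * ((2 * Suc k) choose Suc k) = 2 * Suc k * ((2 * k + 1) choose k)"
    using Suc_times_binomial_eq[of "2 * k + 1" k] by simp
  have "(2 * k + 1) choose k = (2 * k + 1) choose (k + 1)"
    using binomial_symmetric[of k "2 * k + 1"] by simp
  moreover have "Suc k * ((2 * k + 1) choose (k + 1)) = (2 * k + 1) * ((2 * k) choose k)"
    using Suc_times_binomial_eq[of "2 * k" k] by simp
  ultimately have "Suc k * ((2 * Suc k) choose Suc k) = 2 * (2 * k + 1) * ((2 * k) choose k)"
    using 1 by (metis mult.assoc)
  then have "real (Suc k * ((2 * Suc k) choose Suc k)) = real (2 * (2 * k + 1) * ((2 * k) choose k))"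
    by (rule arg_cong)
  then show ?thesis
    by (simp only: of_nat_mult of_nat_add of_nat_numeral of_nat_1)
qed

text \<open>
  Gosper's algorithm yields the antidifference
  \<open>c j * c (m - j) * (2 * j - m) / (2 * m * (m + 1))\<close> of the summand, where
  \<open>c j\<close> is the central binomial coefficient and \<open>m = k + 1\<close>.
\<close>

lemma catalan_recurrence:
  fixes k :: nat
  defines "C \<equiv> \<lambda>j. real ((2 * j) choose j) / real (Suc j)"
  shows "C (Suc k) = (\<Sum>i\<le>k. C i * C (k - i))"
proof -
  define c where "c = (\<lambda>j. real ((2 * j) choose j))"
  define m where "m = Suc k"
  define G where "G = (\<lambda>j. c j * c (m - j) * (2 * real j - real m) / (2 * real m * (real m + 1)))"
  have step: "C i * C (k - i) = G (Suc i) - G i" if "i < Suc k" for i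
  proof -
    define s where "s = k - i"
    have ms: "m - i = Suc s" "m - Suc i = s" "real m = real i + real s + 1"
      using that by (auto simp: m_def s_def)
    have cS: "c (Suc j) = 2 * (2 * real j + 1) * c j / (real j + 1)" for j
      using central_binomial_Suc[of j] unfolding c_def by (simp add: field_simps)
    define x y where "x = real i" and "y = real s"
    have pos: "x + 1 \<noteq> 0" "y + 1 \<noteq> 0" "x + y + 1 \<noteq> 0" "x + y + 2 \<noteq> 0"
      unfolding x_def y_def by linarith+
    \<comment> \<open>Both values of \<open>G\<close> are brought to the common factor
      \<open>c i * c s\<close>, by expanding \<open>c (Suc i)\<close> in one and
      \<open>c (Suc s)\<close> in the other; what remains is the rational identity
      \<open>key\<close> in \<open>x\<close> and \<open>y\<close>.\<close>
    have GS: "G (Suc i) = c i * c s * (2 * (2 * x + 1) * (x - y + 1) / (x + 1)) / (2 * (x + y + 1) * (x + y + 2))"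
      unfolding G_def ms cS by (simp add: x_def y_def algebra_simps)
    have G0: "G i = c i * c s * (2 * (2 * y + 1) * (x - y - 1) / (y + 1)) / (2 * (x + y + 1) * (x + y + 2))"
      unfolding G_def ms cS by (simp add: x_def y_def algebra_simps)
    have key: "2 * (2 * x + 1) * (x - y + 1) / (x + 1) - 2 * (2 * y + 1) * (x - y - 1) / (y + 1)
        = 2 * (x + y + 1) * (x + y + 2) / ((x + 1) * (y + 1))"
      using pos by (simp add: divide_simps) algebra
    have "G (Suc i) - G i = c i * c s * (2 * (2 * x + 1) * (x - y + 1) / (x + 1)
        - 2 * (2 * y + 1) * (x - y - 1) / (y + 1)) / (2 * (x + y + 1) * (x + y + 2))"
      unfolding GS G0 by (simp only: right_diff_distrib diff_divide_distrib)
    also have "\<dots> = c i * c s / ((x + 1) * (y + 1))"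
      unfolding key using pos by simp
    also have "\<dots> = C i * C (k - i)"
      unfolding C_def c_def x_def y_def s_def by (simp add: add.commute)
    finally show ?thesis ..
  qed
  have "(\<Sum>i\<le>k. C i * C (k - i)) = (\<Sum>i<Suc k. G (Suc i) - G i)"
    unfolding lessThan_Suc_atMost[symmetric] by (intro sum.cong refl step) auto
  also have "\<dots> = G m - G 0"
    unfolding m_def by (rule sum_lessThan_telescope)
  \<comment> \<open>\<open>G\<close> changes sign under \<open>j -> m - j\<close>, so the two
    boundary terms contribute half of \<open>C m\<close> each.\<close>
  also have "\<dots> = C m"
  proof -
    have "real m \<noteq> 0" "c 0 = 1"
      by (simp_all add: m_def c_def)
    then have "G m = C m / 2" "G 0 = - (C m / 2)"
      unfolding G_def C_def c_def by (simp_all add: add.commute)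
    then show ?thesis
      by simp
  qed
  finally show ?thesis
    unfolding m_def ..
qed


section \<open>Split functions\<close>

text \<open>The tournament is \<open>edges 1 n\<close>; other intervals arise as the two sides of a
  cut in the recursion.\<close>

definition edges :: "nat \<Rightarrow> nat \<Rightarrow> (nat \<times> nat) set" where
  "edges a b = {(i, j). a \<le> i \<and> i < j \<and> j \<le> b}"

text \<open>
  \<open>f i j\<close> is the index \<open>r\<close> of the unit edge \<open>(r, r + 1)\<close> in the block of the edge \<open>(i, j)\<close>;
  outside the edges, \<open>f\<close> is normalized to 0.
\<close>

definition splits :: "nat \<Rightarrow> nat \<Rightarrow> (nat \<Rightarrow> nat \<Rightarrow> nat) set" where
  "splits a b = {f.
     (\<forall>i j. (i, j) \<notin> edges a b \<longrightarrow> f i j = 0) \<and>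
     (\<forall>i j. (i, j) \<in> edges a b \<longrightarrow> i \<le> f i j \<and> f i j < j) \<and>
     (\<forall>i j m. a \<le> i \<and> i < j \<and> j < m \<and> m \<le> b \<longrightarrow> f i m = f i j \<or> f i m = f j m)}"

lemma splitsD:
  assumes "f \<in> splits a b"
  shows "\<And>i j. (i, j) \<notin> edges a b \<Longrightarrow> f i j = 0"
    and "\<And>i j. \<lbrakk>a \<le> i; i < j; j \<le> b\<rbrakk> \<Longrightarrow> i \<le> f i j \<and> f i j < j"
    and "\<And>i j m. \<lbrakk>a \<le> i; i < j; j < m; m \<le> b\<rbrakk> \<Longrightarrow> f i m = f i j \<or> f i m = f j m"
  using assms unfolding splits_def edges_def by auto

text \<open>The edge \<open>(i, j)\<close> is shortened at one end at a time. The piece cut off has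
  its value on the wrong side of \<open>f i j\<close>, so the triple condition passes
  \<open>f i j\<close> on to the remaining piece.\<close>

lemma splits_across:
  assumes f: "f \<in> splits a b" and "a \<le> i" "i < j" "j \<le> b"
    and "i \<le> x" "x \<le> f i j" "f i j < y" "y \<le> j"
  shows "f x y = f i j"
proof -
  have xj: "f x j = f i j"
  proof (cases "i = x")
    case False
    then have "f i x < x"
      using splitsD(2)[OF f, of i x] assms by auto
    then show ?thesis
      using splitsD(3)[OF f, of i x j] assms False by auto
  qed simp
  show ?thesis
  proof (cases "y = j")
    case False
    then have "y \<le> f y j"
      using splitsD(2)[OF f, of y j] assms by auto
    then show ?thesis
      using splitsD(3)[OF f, of x y j] assms False xj by auto
  qed (use xj in simp)
qed

lemma splits_singleton: "splits a a = {\<lambda>_ _. 0}"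
  unfolding splits_def edges_def by auto

section \<open>Cutting a split function at its value on the longest edge\<close>

definition restrict_split :: "nat \<Rightarrow> nat \<Rightarrow> (nat \<Rightarrow> nat \<Rightarrow> nat) \<Rightarrow> nat \<Rightarrow> nat \<Rightarrow> nat" where
  "restrict_split a b f = (\<lambda>i j. if (i, j) \<in> edges a b then f i j else 0)"

text \<open>For \<open>g\<close> in \<open>splits a r\<close> and \<open>h\<close> in
  \<open>splits (Suc r) b\<close>, the normalization of \<open>g\<close> and \<open>h\<close> makes
  the last two branches 0 outside the edges of the two sides.\<close>

definition glue_splits ::
  "nat \<Rightarrow> nat \<Rightarrow> nat \<Rightarrow> (nat \<Rightarrow> nat \<Rightarrow> nat) \<times> (nat \<Rightarrow> nat \<Rightarrow> nat) \<Rightarrow> nat \<Rightarrow> nat \<Rightarrow> nat" where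
  "glue_splits a r b = (\<lambda>(g, h) i j.
     if a \<le> i \<and> i \<le> r \<and> r < j \<and> j \<le> b then r else if j \<le> r then g i j else h i j)"

lemma restrict_split_in_splits:
  assumes "f \<in> splits a b" "a \<le> a'" "b' \<le> b"
  shows "restrict_split a' b' f \<in> splits a' b'"
  using assms splitsD(2,3)[OF assms(1)]
  unfolding splits_def[of a' b'] restrict_split_def edges_def by auto

text \<open>A triple on one side of the cut inherits its condition from \<open>g\<close> or
  \<open>h\<close>. If the cut separates \<open>i\<close> from \<open>m\<close>, it also separates
  \<open>j\<close> from one of them, and both separated edges have value \<open>r\<close>.\<close>

lemma glue_splits_in_splits:
  assumes g: "g \<in> splits a r" and h: "h \<in> splits (Suc r) b" and r: "a \<le> r" "r < b"
  shows "glue_splits a r b (g, h) \<in> splits a b"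
proof -
  note g = splitsD[OF g] and h = splitsD[OF h]
  have "i \<le> glue_splits a r b (g, h) i j \<and> glue_splits a r b (g, h) i j < j"
    if "a \<le> i" "i < j" "j \<le> b" for i j
    using that g(2)[of i j] h(2)[of i j] by (auto simp: glue_splits_def)
  moreover have "glue_splits a r b (g, h) i j = 0" if "(i, j) \<notin> edges a b" for i j
    using that r g(1)[of i j] h(1)[of i j] by (auto simp: glue_splits_def edges_def)
  moreover have "glue_splits a r b (g, h) i m = glue_splits a r b (g, h) i j \<or>
      glue_splits a r b (g, h) i m = glue_splits a r b (g, h) j m"
    if "a \<le> i" "i < j" "j < m" "m \<le> b" for i j m
    using that g(3)[of i j m] h(3)[of i j m] by (auto simp: glue_splits_def)
  ultimately show ?thesis
    unfolding splits_def edges_def by auto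
qed

lemma bij_betw_restrict_splits:
  assumes r: "a \<le> r" "r < b"
  shows "bij_betw (\<lambda>f. (restrict_split a r f, restrict_split (Suc r) b f))
    {f \<in> splits a b. f a b = r} (splits a r \<times> splits (Suc r) b)"
proof (rule bij_betw_byWitness[where f' = "glue_splits a r b"])
  show "\<forall>f\<in>{f \<in> splits a b. f a b = r}.
      glue_splits a r b (restrict_split a r f, restrict_split (Suc r) b f) = f"
  proof (intro ballI ext)
    fix f i j
    assume "f \<in> {f \<in> splits a b. f a b = r}"
    then have f: "f \<in> splits a b" "f a b = r"
      by auto
    show "glue_splits a r b (restrict_split a r f, restrict_split (Suc r) b f) i j = f i j"
      \<comment> \<open>The restrictions forget the edges across the cut; there
        \<open>splits_across\<close>, applied to \<open>(a, b)\<close>, gives back the value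
        \<open>r\<close>.\<close>
      using r f(2) splitsD(1)[OF f(1), of i j] splits_across[OF f(1), of a b i j]
      by (auto simp: glue_splits_def restrict_split_def edges_def)
  qed
  show "\<forall>p\<in>splits a r \<times> splits (Suc r) b.
      (restrict_split a r (glue_splits a r b p), restrict_split (Suc r) b (glue_splits a r b p)) = p"
  proof (clarify, intro conjI ext)
    fix g h i j
    assume g: "g \<in> splits a r" and h: "h \<in> splits (Suc r) b"
    show "restrict_split a r (glue_splits a r b (g, h)) i j = g i j"
      using splitsD(1)[OF g, of i j]
      by (auto simp: glue_splits_def restrict_split_def edges_def)
    show "restrict_split (Suc r) b (glue_splits a r b (g, h)) i j = h i j"
      using splitsD(1)[OF h, of i j]
      by (auto simp: glue_splits_def restrict_split_def edges_def)
  qed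
  show "(\<lambda>f. (restrict_split a r f, restrict_split (Suc r) b f)) ` {f \<in> splits a b. f a b = r}
      \<subseteq> splits a r \<times> splits (Suc r) b"
    using r restrict_split_in_splits by auto
  show "glue_splits a r b ` (splits a r \<times> splits (Suc r) b) \<subseteq> {f \<in> splits a b. f a b = r}"
    using r glue_splits_in_splits by (auto simp: glue_splits_def)
qed

text \<open>The Catalan index is the length \<open>k\<close> of the interval. The start
  \<open>a\<close> varies in the induction because the right side of a cut starts at a new vertex,
  and finiteness is carried along for the sum of cardinalities.\<close>

lemma card_splits:
  "finite (splits a (a + k)) \<and>
   real (card (splits a (a + k))) = real ((2 * k) choose k) / real (Suc k)"
proof (induction k arbitrary: a rule: less_induct)
  case (less k)
  show ?case
  proof (cases k)
    case 0
    then show ?thesis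
      by (simp add: splits_singleton)
  next
    case (Suc l)
    define C where "C = (\<lambda>j. real ((2 * j) choose j) / real (Suc j))"
    \<comment> \<open>Cutting at \<open>a + i\<close> removes one unit edge and leaves intervals of
      lengths \<open>i\<close> and \<open>l - i\<close>, with sum \<open>k - 1\<close>.\<close>
    define S where "S = (\<lambda>i. {f \<in> splits a (a + k). f a (a + k) = a + i})"
    have Un: "splits a (a + k) = (\<Union>i\<le>l. S i)"
    proof (intro equalityI subsetI)
      fix f
      assume f: "f \<in> splits a (a + k)"
      then have "f a (a + k) - a \<le> l \<and> f a (a + k) = a + (f a (a + k) - a)"
        using splitsD(2)[OF f, of a "a + k"] Suc by auto
      then show "f \<in> (\<Union>i\<le>l. S i)"
        using f unfolding S_def by blast
    qed (auto simp: S_def)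
    have S: "finite (S i) \<and> real (card (S i)) = C i * C (l - i)" if "i \<le> l" for i
    proof -
      have bij: "bij_betw (\<lambda>f. (restrict_split a (a + i) f, restrict_split (Suc (a + i)) (a + k) f))
          (S i) (splits a (a + i) \<times> splits (Suc (a + i)) (a + k))"
        unfolding S_def using that Suc by (intro bij_betw_restrict_splits) auto
      have eq: "Suc (a + i) + (l - i) = a + k"
        using that Suc by simp
      have *: "finite (splits a (a + i))" "real (card (splits a (a + i))) = C i"
        using less[of i a] that Suc unfolding C_def by auto
      have **: "finite (splits (Suc (a + i)) (a + k))"
          "real (card (splits (Suc (a + i)) (a + k))) = C (l - i)"
        using less[of "l - i" "Suc (a + i)", unfolded eq] that Suc unfolding C_def by auto
      show ?thesis
        using bij_betw_finite[OF bij] bij_betw_same_card[OF bij] * **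
        by (simp add: card_cartesian_product)
    qed
    have "real (card (splits a (a + k))) = (\<Sum>i\<le>l. real (card (S i)))"
      unfolding Un using S by (subst card_UN_disjoint) (auto simp: S_def)
    also have "\<dots> = (\<Sum>i\<le>l. C i * C (l - i))"
      using S by simp
    also have "\<dots> = C k"
      unfolding C_def Suc by (rule catalan_recurrence[symmetric])
    finally show ?thesis
      unfolding C_def Un using S by simp
  qed
qed


section \<open>Cycles\<close>

lemma cas_split_at:
  assumes "pre_digraph.cas G u p v" "w \<in> set (pre_digraph.awalk_verts G u p)"
  shows "\<exists>p1 p2. p = p1 @ p2 \<and> pre_digraph.cas G u p1 w \<and> pre_digraph.cas G w p2 v"
  using assms
proof (induction p arbitrary: u)
  case Nil
  then show ?case
    by (auto simp: pre_digraph.cas.simps pre_digraph.awalk_verts.simps)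
next
  case (Cons e p)
  show ?case
  proof (cases "w = u")
    case True
    then have "e # p = [] @ (e # p) \<and> pre_digraph.cas G u [] w \<and> pre_digraph.cas G w (e # p) v"
      using Cons.prems by (simp add: pre_digraph.cas.simps)
    then show ?thesis
      by blast
  next
    case False
    then have "pre_digraph.cas G (head G e) p v"
        "w \<in> set (pre_digraph.awalk_verts G (head G e) p)"
      using Cons.prems by (auto simp: pre_digraph.cas.simps pre_digraph.awalk_verts.simps)
    from Cons.IH[OF this] obtain p1 p2 where "p = p1 @ p2"
        "pre_digraph.cas G (head G e) p1 w" "pre_digraph.cas G w p2 v"
      by blast
    then have "e # p = (e # p1) @ p2 \<and> pre_digraph.cas G u (e # p1) w \<and> pre_digraph.cas G w p2 v"
      using Cons.prems by (simp add: pre_digraph.cas.simps)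
    then show ?thesis
      by blast
  qed
qed

lemma cas_leaves:
  assumes "pre_digraph.cas G u p v" "u \<in> A" "v \<notin> A"
  shows "\<exists>e\<in>set p. tail G e \<in> A \<and> head G e \<notin> A"
  using assms by (induction p arbitrary: u) (auto simp: pre_digraph.cas.simps)

text \<open>If the walk starts in \<open>A\<close>, its portion up to \<open>y\<close> leaves
  \<open>A\<close>; otherwise its portion from \<open>x\<close> back to the start does.\<close>

lemma closed_cas_crosses:
  assumes p: "pre_digraph.cas G u p u"
    and x: "x \<in> set (pre_digraph.awalk_verts G u p)" "x \<in> A"
    and y: "y \<in> set (pre_digraph.awalk_verts G u p)" "y \<notin> A"
  shows "\<exists>e\<in>set p. tail G e \<in> A \<and> head G e \<notin> A"
proof (cases "u \<in> A")
  case True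
  then show ?thesis
    using cas_split_at[OF p y(1)] cas_leaves[of G u _ y A] y(2) by fastforce
next
  case False
  then show ?thesis
    using cas_split_at[OF p x(1)] cas_leaves[of G x _ u A] x(2) by fastforce
qed

lemma cas_ends_in_awalk_verts:
  assumes "pre_digraph.cas G u p v" "e \<in> set p"
  shows "tail G e \<in> set (pre_digraph.awalk_verts G u p)"
    and "head G e \<in> set (pre_digraph.awalk_verts G u p)"
proof -
  have start: "w \<in> set (pre_digraph.awalk_verts G w q)" if "pre_digraph.cas G w q v" for w q
    using that by (cases q) (auto simp: pre_digraph.cas.simps pre_digraph.awalk_verts.simps)
  show "tail G e \<in> set (pre_digraph.awalk_verts G u p)"
    "head G e \<in> set (pre_digraph.awalk_verts G u p)"
    using assms start
    by (induction p arbitrary: u)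
      (auto simp: pre_digraph.cas.simps pre_digraph.awalk_verts.simps)
qed

section \<open>Cycles of the tournament\<close>

lemma pverts_transitive_tournament: "pverts (transitive_tournament n) = {1..n}"
  and parcs_transitive_tournament: "parcs (transitive_tournament n) = edges 1 n"
  by (auto simp: transitive_tournament_def edges_def)

lemma parcs_mk_symmetric_tournament:
  "parcs (mk_symmetric (transitive_tournament n)) = {(i, j). (i, j) \<in> edges 1 n \<or> (j, i) \<in> edges 1 n}"
  by (auto simp: parcs_mk_symmetric parcs_transitive_tournament)

text \<open>Triangles are the cycles from which the triple condition on a partition is
  extracted.\<close>

lemma undirected_cycle_triangle:
  assumes "1 \<le> i" "i < j" "j < m" "m \<le> n"
  shows "undirected_cycle (transitive_tournament n) [(i, j), (j, m), (m, i)]"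
  unfolding undirected_cycle_def pre_digraph.cycle_def
  using assms
  by (auto intro!: exI[of _ i] simp: pre_digraph.awalk_def pre_digraph.cas.simps
      pre_digraph.awalk_verts.simps parcs_mk_symmetric_tournament
      pverts_transitive_tournament edges_def)

text \<open>
  If \<open>a\<close> and \<open>b\<close> are the extreme vertices of the cycle, then the cycle crosses the cut between
  \<open>f a b\<close> and \<open>f a b + 1\<close> in both directions, and all edges crossing it share the block of \<open>(a, b)\<close>.
\<close>

lemma undirected_cycle_split:
  assumes p: "undirected_cycle (transitive_tournament n) p" and f: "f \<in> splits 1 n"
  shows "\<exists>r\<in>{1..<n}. \<exists>x y x' y'. (x, y) \<in> edges 1 n \<and> f x y = r \<and> (x, y) \<in> set p \<and>
    (x', y') \<in> edges 1 n \<and> f x' y' = r \<and> (y', x') \<in> set p"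
proof -
  define G where "G = with_proj (mk_symmetric (transitive_tournament n))"
  have G: "tail G = fst" "head G = snd"
    by (auto simp: G_def)
  obtain u where u: "set p \<subseteq> {(i, j). (i, j) \<in> edges 1 n \<or> (j, i) \<in> edges 1 n}"
      "pre_digraph.cas G u p u"
    using p unfolding undirected_cycle_def pre_digraph.cycle_def pre_digraph.awalk_def G_def
    by (auto simp: parcs_mk_symmetric_tournament)
  define V where "V = fst ` set p \<union> snd ` set p"
  have walk: "v \<in> set (pre_digraph.awalk_verts G u p)" if "v \<in> V" for v
    using that cas_ends_in_awalk_verts[OF u(2)] by (auto simp: V_def G)
  have ends: "x \<in> V" "y \<in> V" if "(x, y) \<in> set p" for x y
    using that by (force simp: V_def)+
  have "p \<noteq> []"
    using p by (auto simp: undirected_cycle_def)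
  then obtain x0 y0 where e0: "(x0, y0) \<in> set p"
    by (cases p) auto
  have V: "finite V" "x0 \<in> V" "y0 \<in> V"
    using ends[OF e0] by (auto simp: V_def)
  define a b where "a = Min V" and "b = Max V"
  have ab: "a \<in> V" "b \<in> V" "\<And>v. v \<in> V \<Longrightarrow> a \<le> v \<and> v \<le> b"
    using V unfolding a_def b_def by (auto intro!: Min_in Max_in)
  have "x0 \<noteq> y0"
    using u(1) e0 by (auto simp: edges_def)
  with ab V have "a < b"
    by (metis leD le_antisym linorder_le_less_linear)
  have "V \<subseteq> {1..n}"
    using u(1) by (fastforce simp: V_def edges_def)
  define r where "r = f a b"
  have "1 \<le> a" "b \<le> n"
    using \<open>V \<subseteq> {1..n}\<close> ab(1,2) by auto
  then have r: "a \<le> r" "r < b" "1 \<le> a" "b \<le> n"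
    using splitsD(2)[OF f, of a b] \<open>a < b\<close> by (auto simp: r_def)
  have cross: "f x y = r \<and> (x, y) \<in> edges 1 n" if "x \<in> V" "y \<in> V" "x \<le> r" "r < y" for x y
    using that splits_across[OF f, of a b x y] r ab(3)[of x] ab(3)[of y] \<open>a < b\<close>
    by (auto simp: r_def edges_def)
  obtain x y where xy: "(x, y) \<in> set p" "x \<le> r" "r < y"
    using closed_cas_crosses[OF u(2), of a "{..r}" b] walk ab r by (auto simp: G)
  obtain y' x' where xy': "(y', x') \<in> set p" "x' \<le> r" "r < y'"
    \<comment> \<open>The complementary set yields a crossing in the other direction: the arc
      \<open>(y', x')\<close> runs against the edge \<open>(x', y')\<close>.\<close>
    using closed_cas_crosses[OF u(2), of b "{r<..}" a] walk ab r by (auto simp: G)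
  show ?thesis
    using xy xy' cross[of x y] cross[of x' y'] ends r by (intro bexI[of _ r]) auto
qed


section \<open>Maximal transitive partitions\<close>

definition block :: "nat \<Rightarrow> (nat \<Rightarrow> nat \<Rightarrow> nat) \<Rightarrow> nat \<Rightarrow> (nat \<times> nat) set" where
  "block n f r = {(i, j) \<in> edges 1 n. f i j = r}"

text \<open>The bounds on \<open>f r (Suc r)\<close> leave only the value \<open>r\<close>. So a
  unit edge reveals the index of its block, which makes the blocks nonempty and distinct.\<close>

lemma unit_edge_in_block:
  assumes "f \<in> splits 1 n" "1 \<le> r" "r < n"
  shows "(r, Suc r) \<in> block n f s \<longleftrightarrow> s = r"
  using splitsD(2)[OF assms(1), of r "Suc r"] assms by (auto simp: block_def edges_def)

section \<open>From split functions to partitions\<close>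

lemma maximal_transitive_partition_blocks:
  assumes f: "f \<in> splits 1 n"
  shows "maximal_transitive_partition n (block n f ` {1..<n})"
proof -
  have "inj_on (block n f) {1..<n}"
    using unit_edge_in_block[OF f] by (intro inj_onI) (metis atLeastLessThan_iff)
  then have "card (block n f ` {1..<n}) = n - 1"
    by (simp add: card_image)
  moreover have "partition_on (edges 1 n) (block n f ` {1..<n})"
  proof (rule partition_onI)
    show "\<Union> (block n f ` {1..<n}) = edges 1 n"
      using splitsD(2)[OF f] by (fastforce simp: block_def edges_def)
    show "{} \<notin> block n f ` {1..<n}"
      using unit_edge_in_block[OF f] by (metis atLeastLessThan_iff empty_iff imageE)
  qed (auto simp: block_def disjnt_def)
  moreover have "\<exists>B\<in>block n f ` {1..<n}. \<exists>e\<in>B. \<exists>e'\<in>B. e \<in> set p \<and> prod.swap e' \<in> set p"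
    if cycle: "undirected_cycle (transitive_tournament n) p" for p
  proof -
    obtain r x y x' y' where "r \<in> {1..<n}" "(x, y) \<in> block n f r" "(x, y) \<in> set p"
        "(x', y') \<in> block n f r" "(y', x') \<in> set p"
      using undirected_cycle_split[OF cycle f] unfolding block_def by blast
    then show ?thesis
      by (metis imageI swap_simp)
  qed
  ultimately show ?thesis
    by (simp add: maximal_transitive_partition_def transitive_partition_def
        parcs_transitive_tournament)
qed

section \<open>From partitions to split functions\<close>

text \<open>Among the arcs of the triangle only \<open>(m, i)\<close> is a reversed edge, so the
  edge traversed backwards is \<open>(i, m)\<close> and the other one is \<open>(i, j)\<close> or
  \<open>(j, m)\<close>.\<close>

lemma transitive_partition_triangle:
  assumes P: "transitive_partition (transitive_tournament n) k P"
    and ijm: "1 \<le> i" "i < j" "j < m" "m \<le> n"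
  shows "\<exists>B\<in>P. (i, m) \<in> B \<and> ((i, j) \<in> B \<or> (j, m) \<in> B)"
proof -
  obtain B e e' where B: "B \<in> P" "e \<in> B" "e' \<in> B" "e \<in> set [(i, j), (j, m), (m, i)]"
      "prod.swap e' \<in> set [(i, j), (j, m), (m, i)]"
    using P undirected_cycle_triangle[OF ijm] unfolding transitive_partition_def by blast
  have "B \<subseteq> edges 1 n"
    using P B(1) by (auto simp: transitive_partition_def partition_on_def parcs_transitive_tournament)
  with B ijm have "e = (i, j) \<or> e = (j, m)" "e' = (i, m)"
    by (auto simp: edges_def prod.swap_def prod_eq_iff)
  with B show ?thesis
    by blast
qed

text \<open>The triangle on \<open>i\<close>, \<open>Suc i\<close>, \<open>m\<close> puts either a
  unit edge or the shorter edge \<open>(Suc i, m)\<close> into the block of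
  \<open>(i, m)\<close>.\<close>

lemma unit_edge_in_block_of_edge:
  assumes P: "transitive_partition (transitive_tournament n) k P"
    and "B \<in> P" "(i, m) \<in> B"
  shows "\<exists>r. i \<le> r \<and> r < m \<and> (r, Suc r) \<in> B"
  using assms(2,3)
proof (induction "m - i" arbitrary: i m rule: less_induct)
  case less
  have part: "partition_on (edges 1 n) P"
    using P by (simp add: transitive_partition_def parcs_transitive_tournament)
  then have im: "1 \<le> i" "i < m" "m \<le> n"
    using less.prems by (auto simp: partition_on_def edges_def)
  show ?case
  proof (cases "m = Suc i")
    case True
    then show ?thesis
      using less.prems by auto
  next
    case False
    then obtain B' where B': "B' \<in> P" "(i, m) \<in> B'" "(i, Suc i) \<in> B' \<or> (Suc i, m) \<in> B'"
      using transitive_partition_triangle[OF P, of i "Suc i" m] im by auto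
    then have "B' = B"
      using part less.prems by (auto simp: partition_on_def disjoint_def)
    with B' consider "(i, Suc i) \<in> B" | "(Suc i, m) \<in> B"
      by blast
    then show ?thesis
    proof cases
      case 1
      then show ?thesis
        using im by auto
    next
      case 2
      moreover have "m - Suc i < m - i"
        using im by linarith
      ultimately obtain r where "Suc i \<le> r" "r < m" "(r, Suc r) \<in> B"
        using less.hyps less.prems(1) by blast
      then show ?thesis
        by (intro exI[of _ r]) auto
    qed
  qed
qed

lemma maximal_transitive_partition_splits:
  assumes "maximal_transitive_partition n P"
  obtains f where "f \<in> splits 1 n" "P = block n f ` {1..<n}"
proof -
  have P: "transitive_partition (transitive_tournament n) (n - 1) P"
    using assms by (simp add: maximal_transitive_partition_def)
  then have part: "partition_on (edges 1 n) P" and card: "card P = n - 1"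
    by (auto simp: transitive_partition_def parcs_transitive_tournament)
  have same: "B = B'" if "B \<in> P" "B' \<in> P" "e \<in> B" "e \<in> B'" for B B' e
    using part that by (auto simp: partition_on_def disjoint_def)
  define \<beta> where "\<beta> = (\<lambda>e. THE B. B \<in> P \<and> e \<in> B)"
  have \<beta>_eq: "\<beta> e = B" if "B \<in> P" "e \<in> B" for e B
    unfolding \<beta>_def
  proof (rule the_equality)
    show "B' = B" if "B' \<in> P \<and> e \<in> B'" for B'
      using same[of B' B e] that \<open>B \<in> P\<close> \<open>e \<in> B\<close> by simp
  qed (use that in simp)
  have \<beta>: "\<beta> e \<in> P" "e \<in> \<beta> e" if e: "e \<in> edges 1 n" for e
  proof -
    obtain B where "B \<in> P" "e \<in> B"
      using part e by (auto simp: partition_on_def)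
    with \<beta>_eq show "\<beta> e \<in> P" "e \<in> \<beta> e"
      by auto
  qed
  define \<gamma> where "\<gamma> = (\<lambda>r. \<beta> (r, Suc r))"
  have image: "P = \<gamma> ` {1..<n}"
  proof (intro equalityI subsetI)
    fix B
    assume B: "B \<in> P"
    then have "B \<noteq> {}"
      using part by (auto simp: partition_on_def)
    then obtain i m where im: "(i, m) \<in> B"
      by auto
    then have "(i, m) \<in> edges 1 n"
      using B part by (auto simp: partition_on_def)
    moreover obtain r where "i \<le> r" "r < m" "(r, Suc r) \<in> B"
      using unit_edge_in_block_of_edge[OF P B im] by auto
    ultimately show "B \<in> \<gamma> ` {1..<n}"
      using \<beta>_eq[OF B, of "(r, Suc r)"] by (auto simp: \<gamma>_def edges_def)
  qed (auto simp: \<gamma>_def edges_def intro: \<beta>)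
  \<comment> \<open>Here the number of blocks enters: \<open>\<gamma>\<close> maps
    \<open>n - 1\<close> indices onto \<open>n - 1\<close> blocks, so no block contains two unit
    edges.\<close>
  have inj: "inj_on \<gamma> {1..<n}"
  proof (rule eq_card_imp_inj_on)
    show "card (\<gamma> ` {1..<n}) = card {1..<n}"
      using card image[symmetric] by simp
  qed simp
  have ex: "\<exists>r. i \<le> r \<and> r < m \<and> \<gamma> r = \<beta> (i, m)" if im: "(i, m) \<in> edges 1 n" for i m
  proof -
    obtain r where "i \<le> r" "r < m" "(r, Suc r) \<in> \<beta> (i, m)"
      using unit_edge_in_block_of_edge[OF P \<beta>[OF im]] by auto
    then show ?thesis
      using \<beta>_eq[OF \<beta>(1)[OF im]] unfolding \<gamma>_def by blast
  qed
  \<comment> \<open>By \<open>inj\<close> the choice is unique on an edge; the default 0 is the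
    normalization in \<open>splits\<close>.\<close>
  define f where "f = (\<lambda>i m. if (i, m) \<in> edges 1 n
    then SOME r. i \<le> r \<and> r < m \<and> \<gamma> r = \<beta> (i, m) else 0)"
  have f: "i \<le> f i m" "f i m < m" "\<gamma> (f i m) = \<beta> (i, m)" if "(i, m) \<in> edges 1 n" for i m
    using someI_ex[OF ex[OF that]] that by (simp_all add: f_def)
  have f_mem: "f i m \<in> {1..<n}" if "(i, m) \<in> edges 1 n" for i m
    using f[OF that] that by (auto simp: edges_def)
  have f_iff: "f i m = r \<longleftrightarrow> \<beta> (i, m) = \<gamma> r" if "(i, m) \<in> edges 1 n" "r \<in> {1..<n}" for i m r
    using inj_on_eq_iff[OF inj f_mem[OF that(1)] that(2)] f(3)[OF that(1)] by simp
  have "f i m = f i j \<or> f i m = f j m" if ijm: "1 \<le> i" "i < j" "j < m" "m \<le> n" for i j m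
  proof -
    have E: "(i, m) \<in> edges 1 n" "(i, j) \<in> edges 1 n" "(j, m) \<in> edges 1 n"
      using ijm by (auto simp: edges_def)
    obtain B where "B \<in> P" "(i, m) \<in> B" "(i, j) \<in> B \<or> (j, m) \<in> B"
      using transitive_partition_triangle[OF P ijm] by auto
    then have "\<beta> (i, m) = \<beta> (i, j) \<or> \<beta> (i, m) = \<beta> (j, m)"
      using \<beta>_eq by metis
    then show ?thesis
      using f_iff f_mem f(3) E by metis
  qed
  then have "f \<in> splits 1 n"
    using f(1,2) unfolding splits_def by (auto simp: f_def)
  moreover have "block n f r = \<gamma> r" if r: "r \<in> {1..<n}" for r
  proof -
    have "\<gamma> r \<in> P"
      using r image by blast
    then have "\<gamma> r \<subseteq> edges 1 n"
      using part by (auto simp: partition_on_def)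
    moreover have "(i, m) \<in> \<gamma> r \<longleftrightarrow> f i m = r" if im: "(i, m) \<in> edges 1 n" for i m
    proof -
      have "(i, m) \<in> \<gamma> r \<longleftrightarrow> \<beta> (i, m) = \<gamma> r"
        using \<beta>_eq[OF \<open>\<gamma> r \<in> P\<close>] \<beta>(2)[OF im] by metis
      then show ?thesis
        using f_iff[OF im r] by simp
    qed
    ultimately show ?thesis
      unfolding block_def by blast
  qed
  then have "P = block n f ` {1..<n}"
    unfolding image by (intro image_cong) auto
  ultimately show ?thesis
    using that by blast
qed

text \<open>Equal partitions match a block of \<open>f\<close> with some block of \<open>g\<close>,
  a priori of another index; the unit edge in it shows that the indices agree.\<close>

lemma inj_on_blocks: "inj_on (\<lambda>f. block n f ` {1..<n}) (splits 1 n)"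
proof (intro inj_onI ext)
  fix f g i j
  assume f: "f \<in> splits 1 n" and g: "g \<in> splits 1 n"
    and eq: "block n f ` {1..<n} = block n g ` {1..<n}"
  show "f i j = g i j"
  proof (cases "(i, j) \<in> edges 1 n")
    case True
    define r where "r = f i j"
    have r: "r \<in> {1..<n}"
      using splitsD(2)[OF f, of i j] True by (auto simp: r_def edges_def)
    then obtain s where s: "block n f r = block n g s"
      using eq by blast
    then have "s = r"
      using unit_edge_in_block[OF f, of r r] unit_edge_in_block[OF g, of r s] r by auto
    then have "(i, j) \<in> block n g r"
      using s True by (auto simp: block_def r_def)
    then show ?thesis
      by (simp add: block_def r_def)
  qed (use splitsD(1)[OF f] splitsD(1)[OF g] in auto)
qed

theorem theorem1p19:
  fixes n :: nat
  assumes "n > 1"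
  shows "real (card {P. maximal_transitive_partition n P})
           = 1 / real n * real ((2 * n - 2) choose (n - 1))"
proof -
  have "{P. maximal_transitive_partition n P} = (\<lambda>f. block n f ` {1..<n}) ` splits 1 n"
    using maximal_transitive_partition_blocks maximal_transitive_partition_splits by blast
  \<comment> \<open>The form \<open>1 + (n - 1)\<close> fits \<open>card_splits\<close> with
    \<open>k = n - 1\<close>, so that its denominator \<open>Suc k\<close> becomes
    \<open>n\<close>.\<close>
  then have "card {P. maximal_transitive_partition n P} = card (splits 1 (1 + (n - 1)))"
    using assms card_image[OF inj_on_blocks, of n] by simp
  then show ?thesis
    using card_splits[of 1 "n - 1"] assms by (simp add: diff_mult_distrib2)
qed

end
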